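(* Let $q$ be a power of a prime and let $n,m$ be integers with $1\le m<n$. Then the Grassmann graph $J_q(n,m)$ is a pseudo-core; that is, every endomorphism of $J_q(n,m)$ is either an automorphism or a colouring.
   Context: $\mathbb{F}_q$ denotes the finite field with $q$ elements and $V$ an $n$-dimensional vector space over $\mathbb{F}_q$. The Grassmann graph $J_q(n,m)$ is the simple undirected graph whose vertices are the $m$-dimensional subspaces of $V$, two vertices $X,Y$ being adjacent iff $\dim(X\cap Y)=m-1$. An endomorphism of a graph $G$ is a map $\varphi:V(G)\to V(G)$ such that $\varphi(x)\sim\varphi(y)$ whenever $x\sim y$. An automorphism is a bijection $V(G)\to V(G)$ with $x\sim y \Leftrightarrow \varphi(x)\sim\varphi(y)$. An endomorphism $\varphi$ is called a colouring if its image is a clique of $G$ (i.e. any two distinct vertices of the image are adjacent), so that $\varphi$ is a homomorphism to a complete graph. A graph is a pseudo-core if every endomorphism of it is either an automorphism or a colouring. *)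

theory Defs
  imports
    "Graph_Theory.Pair_Digraph"
    "HOL-Library.Cardinality"
    "HOL-Number_Theory.Prime_Powers"
begin

text \<open>
  Simple undirected graphs are represented as in \<^theory>\<open>Graph_Theory.Pair_Digraph\<close>, by a vertex
  set and a symmetric irreflexive set of arcs (locale \<^locale>\<open>pair_graph\<close>).  Graph maps are total
  HOL functions; only their values on the vertex set matter.
\<close>

definition graph_endomorphism :: "'a pair_pre_digraph \<Rightarrow> ('a \<Rightarrow> 'a) \<Rightarrow> bool" where
  "graph_endomorphism G f \<longleftrightarrow>
     f ` pverts G \<subseteq> pverts G \<and>
     (\<forall>x\<in>pverts G. \<forall>y\<in>pverts G. (x, y) \<in> parcs G \<longrightarrow> (f x, f y) \<in> parcs G)"

definition graph_automorphism :: "'a pair_pre_digraph \<Rightarrow> ('a \<Rightarrow> 'a) \<Rightarrow> bool" where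
  "graph_automorphism G f \<longleftrightarrow>
     bij_betw f (pverts G) (pverts G) \<and>
     (\<forall>x\<in>pverts G. \<forall>y\<in>pverts G. (x, y) \<in> parcs G \<longleftrightarrow> (f x, f y) \<in> parcs G)"

definition graph_clique :: "'a pair_pre_digraph \<Rightarrow> 'a set \<Rightarrow> bool" where
  "graph_clique G C \<longleftrightarrow>
     C \<subseteq> pverts G \<and> (\<forall>x\<in>C. \<forall>y\<in>C. x \<noteq> y \<longrightarrow> (x, y) \<in> parcs G)"

definition graph_colouring :: "'a pair_pre_digraph \<Rightarrow> ('a \<Rightarrow> 'a) \<Rightarrow> bool" where
  "graph_colouring G f \<longleftrightarrow> graph_endomorphism G f \<and> graph_clique G (f ` pverts G)"

text \<open>
  The disjunction is inclusive: in a complete graph every automorphism is also a colouring.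
\<close>

definition pseudo_core :: "'a pair_pre_digraph \<Rightarrow> bool" where
  "pseudo_core G \<longleftrightarrow>
     (\<forall>f. graph_endomorphism G f \<longrightarrow> graph_automorphism G f \<or> graph_colouring G f)"

context vector_space
begin

text \<open>
  The Grassmann graph of the whole space.  The condition \<open>dim (X \<inter> Y) + 1 = m\<close> is
  \<open>dim (X \<inter> Y) = m - 1\<close> without truncated subtraction, which would create a loop for \<open>m = 0\<close>.
\<close>

definition grassmann_graph :: "nat \<Rightarrow> 'b set pair_pre_digraph" where
  "grassmann_graph m =
     \<lparr> pverts = {X. subspace X \<and> dim X = m},
       parcs = {(X, Y). subspace X \<and> dim X = m \<and> subspace Y \<and> dim Y = m \<and>
                        dim (X \<inter> Y) + 1 = m} \<rparr>"

end

lemma pair_graph_grassmann_graph: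
  fixes scale :: "'a::field \<Rightarrow> 'v::{ab_group_add,finite} \<Rightarrow> 'v"
  assumes "vector_space scale"
  shows "pair_graph (vector_space.grassmann_graph scale m)"
proof -
  interpret vector_space scale by fact
  let ?G = "grassmann_graph m"
  have arc: "(X, Y) \<in> parcs ?G \<Longrightarrow> X \<in> pverts ?G \<and> Y \<in> pverts ?G \<and> X \<noteq> Y \<and> (Y, X) \<in> parcs ?G" for X Y
    by (simp add: grassmann_graph_def Int_commute) (metis Int_absorb n_not_Suc_n)
  have fin: "finite (A :: 'v set set)" "finite (R :: 'v set rel)" for A R
    by (rule finite)+
  show ?thesis
  proof
    show "finite (pverts ?G)" "finite (parcs ?G)"
      by (rule fin)+
    show "symmetric (with_proj ?G)"
      unfolding symmetric_def with_proj_simps by (rule symI) (blast dest: arc)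
  next
    fix e assume "e \<in> parcs ?G"
    then show "fst e \<in> pverts ?G" "snd e \<in> pverts ?G" "fst e \<noteq> snd e"
      by (metis arc prod.collapse)+
  qed
qed

end

theory Submission
  imports Defs
begin

text \<open>
  For \<open>2 \<le> m \<le> n - 2\<close> the maximal cliques of the Grassmann graph are the stars (all vertices above
  an \<open>(m - 1)\<close>-space) and the tops (all vertices below an \<open>(m + 1)\<close>-space); a star and a top that
  meet share a line, and all lines have the same size.  An endomorphism \<open>f\<close> is injective on cliques,
  so it sends each maximal clique into another.  If some star and some top that meet are sent into
  the same clique \<open>K\<close>, then counting on lines shows that all cliques through a common vertex are
  sent into \<open>K\<close>, and by connectedness \<open>f\<close> is a colouring.  Otherwise a star and a top that meet go
  to cliques of different kinds, so by connectedness \<open>f\<close> either preserves or exchanges the two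
  kinds, and \<open>f\<close> or \<open>f \<circ> f\<close> preserves them.  A map preserving the kinds is, by cardinality, onto
  on each clique; its image is then closed under adjacency, so it is surjective, and \<open>f\<close> is an
  automorphism.  For \<open>m = 1\<close> and \<open>m = n - 1\<close> the graph is complete.
\<close>

section \<open>Endomorphisms of graphs with two kinds of cliques\<close>

text \<open>The model is the Grassmann graph, with \<open>S\<close> the stars, \<open>T\<close> the
  tops and \<open>k\<close> the size of a line, the common part of a star and a top that meet.
  \<open>three_T\<close> provides two tops through a vertex besides a given one, as the counting
  below requires. Connectedness takes the form of an induction principle: a nonempty vertex set
  closed under neighbours is everything.\<close>

locale biclique_space =
  fixes V :: "'x set" and adj :: "'x \<Rightarrow> 'x \<Rightarrow> bool" and S T :: "'x set set" and k :: nat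
  assumes finite_V: "finite V"
    and clique_subset: "C \<in> S \<union> T \<Longrightarrow> C \<subseteq> V"
    and adj_neq: "adj x y \<Longrightarrow> x \<noteq> y"
    and adj_in_clique: "C \<in> S \<union> T \<Longrightarrow> x \<in> C \<Longrightarrow> y \<in> C \<Longrightarrow> x \<noteq> y \<Longrightarrow> adj x y"
    and ex_S: "adj x y \<Longrightarrow> \<exists>C\<in>S. x \<in> C \<and> y \<in> C"
    and ex_T: "adj x y \<Longrightarrow> \<exists>D\<in>T. x \<in> D \<and> y \<in> D"
    and unique_S: "C \<in> S \<Longrightarrow> C' \<in> S \<Longrightarrow> x \<in> C \<inter> C' \<Longrightarrow> y \<in> C \<inter> C' \<Longrightarrow> x \<noteq> y \<Longrightarrow> C = C'"
    and unique_T: "D \<in> T \<Longrightarrow> D' \<in> T \<Longrightarrow> x \<in> D \<inter> D' \<Longrightarrow> y \<in> D \<inter> D' \<Longrightarrow> x \<noteq> y \<Longrightarrow> D = D'"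
    and clique_cover: "K \<subseteq> V \<Longrightarrow> (\<And>x y. x \<in> K \<Longrightarrow> y \<in> K \<Longrightarrow> x \<noteq> y \<Longrightarrow> adj x y) \<Longrightarrow> \<exists>C\<in>S \<union> T. K \<subseteq> C"
    and k_ge_2: "2 \<le> k"
    and card_line: "C \<in> S \<Longrightarrow> D \<in> T \<Longrightarrow> C \<inter> D \<noteq> {} \<Longrightarrow> card (C \<inter> D) = k"
    and card_S: "C \<in> S \<Longrightarrow> C' \<in> S \<Longrightarrow> card C = card C'"
    and card_T: "D \<in> T \<Longrightarrow> D' \<in> T \<Longrightarrow> card D = card D'"
    and two_S: "x \<in> V \<Longrightarrow> \<exists>C\<in>S. \<exists>C'\<in>S. C \<noteq> C' \<and> x \<in> C \<and> x \<in> C'"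
    and three_T: "x \<in> V \<Longrightarrow> \<exists>D\<in>T. \<exists>D'\<in>T. \<exists>D''\<in>T. D \<noteq> D' \<and> D \<noteq> D'' \<and> D' \<noteq> D'' \<and> x \<in> D \<and> x \<in> D' \<and> x \<in> D''"
    and connected: "W \<subseteq> V \<Longrightarrow> W \<noteq> {} \<Longrightarrow> (\<And>x y. x \<in> W \<Longrightarrow> adj x y \<Longrightarrow> y \<in> W) \<Longrightarrow> W = V"
begin

lemma adj_in_V: "adj x y \<Longrightarrow> x \<in> V \<and> y \<in> V"
  using ex_S clique_subset by blast

lemma finite_clique: "C \<in> S \<union> T \<Longrightarrow> finite C"
  using clique_subset finite_V finite_subset by metis

lemma line_other_point:
  assumes "C \<in> S" "D \<in> T" "x \<in> C" "x \<in> D"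
  obtains y where "y \<in> C" "y \<in> D" "y \<noteq> x"
proof -
  have "card (C \<inter> D) \<ge> 2" using card_line[of C D] assms k_ge_2 by auto
  then have "\<not> C \<inter> D \<subseteq> {x}"
    using card_mono[of "{x}" "C \<inter> D"] by auto
  then show ?thesis using that by auto
qed

text \<open>Such a set would share a second point with every member of \<open>T\<close> through
  \<open>x\<close>, so \<open>unique_T\<close> would make it the only one, against
  \<open>three_T\<close>. Hence a nonempty clique has exactly one kind.\<close>

lemma S_T_no_common_member:
  assumes "C \<in> S" "C \<in> T" "x \<in> C" shows False
proof -
  have eq: "D = C" if D: "D \<in> T" "x \<in> D" for D
  proof -
    obtain y where "y \<in> C" "y \<in> D" "y \<noteq> x" using line_other_point assms D by blast
    then show ?thesis using unique_T[of D C x y] assms D by auto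
  qed
  have "x \<in> V" using assms clique_subset by blast
  from three_T[OF this] eq show False by metis
qed

text \<open>Pigeonhole: both images fill \<open>L\<close>, so a point of \<open>M\<close> other than
  \<open>x\<close> has the same image as some point of \<open>N\<close>. Injectivity puts that point
  into \<open>M \<inter> N\<close>.\<close>

lemma line_pair_overflow:
  assumes inj: "inj_on f E" and E: "M \<subseteq> E" "N \<subseteq> E" "M \<inter> N = {x}"
    and cards: "card M = k" "card N = k"
    and im: "f ` M \<subseteq> L" "f ` N \<subseteq> L" and L: "card L = k"
  shows False
proof -
  have fin: "finite L" "finite M" "finite N"
    using L cards k_ge_2 card.infinite by fastforce+
  have i: "inj_on f M" "inj_on f N" using inj E inj_on_subset by blast+
  have 1: "f ` M = L" using im(1) fin i(1) cards L by (simp add: card_image card_subset_eq)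
  have 2: "f ` N = L" using im(2) fin i(2) cards L by (simp add: card_image card_subset_eq)
  have "M \<noteq> {x}" using cards k_ge_2 by auto
  moreover have "x \<in> M" using E by auto
  ultimately obtain y where y: "y \<in> M" "y \<noteq> x" by auto
  then obtain z where z: "z \<in> N" "f z = f y" using 1 2 by (metis imageE imageI)
  then have "z = y" using inj y E(1,2) by (metis inj_onD subsetD)
  then show False using y z E by auto
qed

end

section \<open>How an endomorphism acts on the two kinds of cliques\<close>

locale biclique_endo = biclique_space +
  fixes f :: "'x \<Rightarrow> 'x"
  assumes endo_in_V: "x \<in> V \<Longrightarrow> f x \<in> V" and endo_adj: "adj x y \<Longrightarrow> adj (f x) (f y)"
begin

lemma endo_inj_on_clique: "C \<in> S \<union> T \<Longrightarrow> inj_on f C"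
  by (rule inj_onI) (metis adj_in_clique adj_neq endo_adj)

lemma endo_clique_cover:
  assumes "C \<in> S \<union> T" shows "\<exists>C'\<in>S \<union> T. f ` C \<subseteq> C'"
proof (rule clique_cover)
  show "f ` C \<subseteq> V" using clique_subset[OF assms] endo_in_V by auto
  show "adj x y" if "x \<in> f ` C" "y \<in> f ` C" "x \<noteq> y" for x y
    using that adj_in_clique[OF assms] endo_adj by auto
qed

text \<open>An enclosing clique is fixed by choice, so that two cliques being merged becomes an
  equation between covers.\<close>

definition cover :: "'x set \<Rightarrow> 'x set" where
  "cover C = (SOME C'. C' \<in> S \<union> T \<and> f ` C \<subseteq> C')"

lemma cover: assumes "C \<in> S \<union> T" shows "cover C \<in> S \<union> T" "f ` C \<subseteq> cover C"
  using someI_ex[of "\<lambda>C'. C' \<in> S \<union> T \<and> f ` C \<subseteq> C'"] endo_clique_cover[OF assms]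
  unfolding cover_def by blast+

definition opposite :: "'x set \<Rightarrow> 'x set \<Rightarrow> bool" where
  "opposite C D \<longleftrightarrow> C \<in> S \<and> D \<in> T \<or> C \<in> T \<and> D \<in> S"

text \<open>Two points of the line \<open>C \<inter> D\<close> have distinct images in both covers,
  and two cliques of the same kind sharing two points coincide.\<close>

lemma cover_eq_or_opposite:
  assumes "C \<in> S" "D \<in> T" "x \<in> C" "x \<in> D"
  shows "cover C = cover D \<or> opposite (cover C) (cover D)"
proof -
  obtain y where y: "y \<in> C" "y \<in> D" "y \<noteq> x" using line_other_point assms by blast
  have ne: "f x \<noteq> f y" using endo_inj_on_clique[of C] assms y by (auto dest: inj_onD)
  have mem: "f x \<in> cover C \<inter> cover D" "f y \<in> cover C \<inter> cover D"
    using cover(2)[of C] cover(2)[of D] assms y by auto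
  show ?thesis using cover(1)[of C] cover(1)[of D] assms unique_S[OF _ _ mem ne] unique_T[OF _ _ mem ne]
    unfolding opposite_def by blast
qed

lemma card_opposite: "opposite C D \<Longrightarrow> x \<in> C \<Longrightarrow> x \<in> D \<Longrightarrow> card (C \<inter> D) = k"
  unfolding opposite_def using card_line[of C D] card_line[of D C] by (auto simp: Int_commute)

text \<open>The lines \<open>E \<inter> F1\<close> and \<open>E \<inter> F2\<close> meet only in
  \<open>x\<close>, yet both are sent into the single line \<open>K \<inter> L\<close>, which is too
  small since \<open>f\<close> is injective on \<open>E\<close>. Phrasing it with
  \<open>opposite\<close> lets \<open>E\<close> be of either kind.\<close>

lemma cover_lines_overflow:
  assumes "opposite K L" "E \<in> S \<union> T" "x \<in> E" "cover E = K"
    and F: "F1 \<in> S \<union> T" "x \<in> F1" "opposite E F1" "cover F1 = L"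
    and G: "F2 \<in> S \<union> T" "x \<in> F2" "opposite E F2" "cover F2 = L"
    and disj: "E \<inter> F1 \<inter> F2 = {x}"
  shows False
proof (rule line_pair_overflow[where M = "E \<inter> F1" and N = "E \<inter> F2" and L = "K \<inter> L" and E = E
  and f = f and x = x])
  show "inj_on f E" using assms endo_inj_on_clique by blast
  show "card (E \<inter> F1) = k" "card (E \<inter> F2) = k" using assms card_opposite by blast+
  show "f ` (E \<inter> F1) \<subseteq> K \<inter> L" "f ` (E \<inter> F2) \<subseteq> K \<inter> L" using assms cover(2) by blast+
  have "f x \<in> K \<inter> L" using assms cover(2) by blast
  then show "card (K \<inter> L) = k" using card_opposite assms by blast
qed (use disj in auto)

lemma opposite_ST: "C \<in> S \<Longrightarrow> D \<in> T \<Longrightarrow> opposite C D"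
  and opposite_TS: "C \<in> T \<Longrightarrow> D \<in> S \<Longrightarrow> opposite C D"
  unfolding opposite_def by auto

lemma opposite_sym: "opposite C D \<longleftrightarrow> opposite D C"
  unfolding opposite_def by auto

text \<open>The cliques through a vertex form a grid, and an endomorphism acts on it like an endomorphism
  of a rook's graph with at least three columns: once a row and a column are merged, all are.\<close>

lemma cover_constant_local:
  assumes C0: "C0 \<in> S" "x \<in> C0" and D0: "D0 \<in> T" "x \<in> D0" and K: "cover C0 = cover D0"
    and E: "E \<in> S \<union> T" "x \<in> E"
  shows "cover E = cover C0"
proof -
  have xV: "x \<in> V" using C0 clique_subset by blast
  have tri_T: "C \<inter> D \<inter> D' = {x}"
    if "C \<in> S" "D \<in> T" "D' \<in> T" "x \<in> C" "x \<in> D" "x \<in> D'" "D \<noteq> D'" for C D D'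
    using unique_T[of D D' x] that by blast
  have tri_S: "D \<inter> C \<inter> C' = {x}"
    if "D \<in> T" "C \<in> S" "C' \<in> S" "x \<in> D" "x \<in> C" "x \<in> C'" "C \<noteq> C'" for C C' D
    using unique_S[of C C' x] that by blast
  have all_S: "cover C = cover C0" if C: "C \<in> S" "x \<in> C" for C
  proof (rule ccontr)
    assume ne: "cover C \<noteq> cover C0"
    let ?K = "cover C0" and ?L = "cover C"
    have opp: "opposite ?L ?K" using cover_eq_or_opposite[OF C(1) D0(1) C(2) D0(2)] ne K by simp
    \<comment> \<open>A third cover would be opposite to both \<open>?K\<close> and
      \<open>?L\<close>. These have different kinds, so it would have both kinds while containing
      \<open>f x\<close>.\<close>
    have KL: "cover D = ?K \<or> cover D = ?L" if D: "D \<in> T" "x \<in> D" for D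
    proof -
      have 1: "cover C0 = cover D \<or> opposite (cover C0) (cover D)" using cover_eq_or_opposite C0 D
        by blast
      have 2: "cover C = cover D \<or> opposite (cover C) (cover D)" using cover_eq_or_opposite C D
        by blast
      have "f x \<in> cover D" "f x \<in> ?K" "f x \<in> ?L" using cover(2) C0 C D by blast+
      then show ?thesis using 1 2 opp S_T_no_common_member unfolding opposite_def by metis
    qed
    \<comment> \<open>Otherwise the two lines that \<open>D0\<close> and \<open>D\<close> cut out of
      \<open>C\<close> would both go into \<open>?L \<inter> ?K\<close>.\<close>
    have L: "cover D = ?L" if D: "D \<in> T" "x \<in> D" "D \<noteq> D0" for D
    proof (rule ccontr)
      assume "cover D \<noteq> ?L"
      then have "cover D = ?K" using KL D by blast
      then show False
        by (intro cover_lines_overflow[OF opp, of C x D0 D])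
          (use C D0 D K[symmetric] tri_T[of C D0 D] in \<open>simp_all add: opposite_ST\<close>)
    qed
    \<comment> \<open>Two members of \<open>T\<close> other than \<open>D0\<close> now have cover
      \<open>?L\<close>, so the two lines they cut out of \<open>C0\<close> are crowded into
      \<open>?K \<inter> ?L\<close>.\<close>
    obtain D1 D2 where D12: "D1 \<in> T" "D2 \<in> T" "D1 \<noteq> D2" "x \<in> D1" "x \<in> D2" "D1 \<noteq> D0" "D2 \<noteq> D0"
      using three_T[OF xV] by metis
    have opp': "opposite ?K ?L" using opp opposite_sym by blast
    show False
      by (rule cover_lines_overflow[OF opp', of C0 x D1 D2])
        (use D12 C0 L tri_T[of C0 D1 D2] in \<open>simp_all add: opposite_ST\<close>)
  qed
  show ?thesis
  proof (cases "E \<in> S")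
    case True then show ?thesis using all_S E by blast
  next
    case False
    then have ET: "E \<in> T" using E by blast
    show ?thesis
    proof (rule ccontr)
      assume ne: "cover E \<noteq> cover C0"
      then have opp: "opposite (cover E) (cover C0)"
        using cover_eq_or_opposite[OF C0(1) ET C0(2) E(2)] opposite_sym by metis
      \<comment> \<open>All members of \<open>S\<close> through \<open>x\<close> already share the
        cover of \<open>C0\<close>, so any two of them cut out of \<open>E\<close> lines that go
        into the same line.\<close>
      obtain C1 C2 where C12: "C1 \<in> S" "C2 \<in> S" "C1 \<noteq> C2" "x \<in> C1" "x \<in> C2" using two_S[OF xV]
        by blast
      show False
        by (rule cover_lines_overflow[OF opp, of E x C1 C2])
          (use C12 ET E all_S tri_S[of E C1 C2] in \<open>simp_all add: opposite_TS\<close>)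
    qed
  qed
qed

text \<open>Merging spreads along edges: an edge lies in a member of \<open>S\<close> and a member
  of \<open>T\<close>. If these are merged at one end, they form a merged pair at the other end too,
  and \<open>cover_constant_local\<close> applies there.\<close>

lemma merged_flag_imp_image_in_clique:
  assumes C0: "C0 \<in> S" "x \<in> C0" and D0: "D0 \<in> T" "x \<in> D0" and K: "cover C0 = cover D0"
  shows "f ` V \<subseteq> cover C0"
proof -
  define W where "W = {y \<in> V. \<forall>E\<in>S \<union> T. y \<in> E \<longrightarrow> cover E = cover C0}"
  have xV: "x \<in> V" using C0 clique_subset by blast
  have "W = V"
  proof (rule connected)
    show "W \<subseteq> V" by (auto simp: W_def)
    have "x \<in> W" using cover_constant_local[OF assms] xV by (auto simp: W_def)
    then show "W \<noteq> {}" by blast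
    fix y z assume y: "y \<in> W" and a: "adj y z"
    obtain C D where CD: "C \<in> S" "y \<in> C" "z \<in> C" "D \<in> T" "y \<in> D" "z \<in> D" using ex_S ex_T a by metis
    have CD_cover: "cover C = cover C0" "cover D = cover C0" using y CD by (auto simp: W_def)
    have "cover E = cover C0" if "E \<in> S \<union> T" "z \<in> E" for E
      using cover_constant_local[of C z D E] CD CD_cover that by metis
    then show "z \<in> W" using adj_in_V[OF a] by (auto simp: W_def)
  qed
  moreover have "f y \<in> cover C0" if "y \<in> W" for y
  proof -
    have yV: "y \<in> V" using that by (auto simp: W_def)
    then obtain C where "C \<in> S" "y \<in> C" using two_S by blast
    then show ?thesis using that cover(2)[of C] by (auto simp: W_def)
  qed
  ultimately show ?thesis by blast
qed

text \<open>The parameters \<open>X\<close> and \<open>Y\<close> treat at once the case where kinds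
  are preserved (\<open>X = S\<close>) and the case where they are exchanged (\<open>X = T\<close>).
  Kinds pass from a vertex to its neighbour through a clique containing both.\<close>

lemma cover_types_constant:
  assumes XY: "X = S \<and> Y = T \<or> X = T \<and> Y = S"
    and opp: "\<And>C D x. C \<in> S \<Longrightarrow> D \<in> T \<Longrightarrow> x \<in> C \<Longrightarrow> x \<in> D \<Longrightarrow> opposite (cover C) (cover D)"
    and C0: "C0 \<in> S" "x0 \<in> C0" "cover C0 \<in> X"
  shows "C \<in> S \<Longrightarrow> x \<in> C \<Longrightarrow> cover C \<in> X" and "D \<in> T \<Longrightarrow> x \<in> D \<Longrightarrow> cover D \<in> Y"
proof -
  define W where "W = {x\<in>V. (\<forall>C\<in>S. x \<in> C \<longrightarrow> cover C \<in> X) \<and> (\<forall>D\<in>T. x \<in> D \<longrightarrow> cover D \<in> Y)}"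
  have no_common: "\<not> (cover C \<in> S \<and> cover C \<in> T)" if "C \<in> S \<union> T" "x \<in> C" for C x
    using S_T_no_common_member[of "cover C" "f x"] cover(2)[OF that(1)] that(2) by blast
  have in_V: "x \<in> V" if "C \<in> S \<union> T" "x \<in> C" for C x
    using that clique_subset by blast
  \<comment> \<open>One member of \<open>S\<close> at \<open>x\<close> with cover in
    \<open>X\<close> forces the cover of every member of \<open>T\<close> there into
    \<open>Y\<close>, and any one of those forces the covers of all members of \<open>S\<close>
    there into \<open>X\<close>.\<close>
  have in_W: "x \<in> W" if C: "C \<in> S" "x \<in> C" "cover C \<in> X" for x C
  proof -
    have x: "x \<in> V" using in_V C by blast
    have T: "cover D \<in> Y" if D: "D \<in> T" "x \<in> D" for D
      using opp[OF C(1) D(1) C(2) D(2)] C XY no_common[of C x] unfolding opposite_def by blast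
    obtain D where D: "D \<in> T" "x \<in> D" using three_T x by blast
    have "cover C' \<in> X" if C': "C' \<in> S" "x \<in> C'" for C'
      using opp[OF C'(1) D(1) C'(2) D(2)] D XY no_common[of D x] T[OF D] unfolding opposite_def
      by blast
    then show ?thesis using T x by (auto simp: W_def)
  qed
  have "W = V"
  proof (rule connected)
    show "W \<subseteq> V" by (auto simp: W_def)
    show "W \<noteq> {}" using in_W C0 by blast
    fix y z assume y: "y \<in> W" and a: "adj y z"
    obtain C where C: "C \<in> S" "y \<in> C" "z \<in> C" using ex_S a by blast
    then have "cover C \<in> X" using y by (auto simp: W_def)
    then show "z \<in> W" using in_W C by blast
  qed
  then have all: "x \<in> W" if "C \<in> S \<union> T" "x \<in> C" for C x
    using in_V that by blast
  show "cover C \<in> X" if "C \<in> S" "x \<in> C"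
    using all[of C x] that by (auto simp: W_def)
  show "cover D \<in> Y" if "D \<in> T" "x \<in> D"
    using all[of D x] that by (auto simp: W_def)
qed

text \<open>Equal cardinalities within a kind and injectivity make \<open>f\<close> map each clique
  onto a clique of its kind. The image of \<open>V\<close> is then shown to be closed under
  neighbours.\<close>

lemma surj_if_type_preserving:
  assumes pS: "\<And>C x. C \<in> S \<Longrightarrow> x \<in> C \<Longrightarrow> \<exists>C'\<in>S. f ` C \<subseteq> C'"
    and pT: "\<And>D x. D \<in> T \<Longrightarrow> x \<in> D \<Longrightarrow> \<exists>D'\<in>T. f ` D \<subseteq> D'"
    and V: "V \<noteq> {}"
  shows "f ` V = V"
proof (rule connected)
  show "f ` V \<subseteq> V" using endo_in_V by blast
  show "f ` V \<noteq> {}" using V by blast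
  have onto_S: "f ` C = C'" if "C \<in> S" "C' \<in> S" "f ` C \<subseteq> C'" for C C'
    using that endo_inj_on_clique[of C] card_S[of C C'] finite_clique[of C']
    by (simp add: card_image card_subset_eq)
  have onto_T: "f ` D = D'" if "D \<in> T" "D' \<in> T" "f ` D \<subseteq> D'" for D D'
    using that endo_inj_on_clique[of D] card_T[of D D'] finite_clique[of D']
    by (simp add: card_image card_subset_eq)
  fix u y assume "u \<in> f ` V" and a: "adj u y"
  then obtain x where x: "x \<in> V" "u = f x" by blast
  obtain C' where C': "C' \<in> S" "f x \<in> C'" "y \<in> C'" using ex_S a x by blast
  obtain D where D: "D \<in> T" "x \<in> D" using three_T x by blast
  then obtain D' where D': "D' \<in> T" "f ` D = D'" using pT onto_T by metis
  \<comment> \<open>The clique \<open>C'\<close> is not known to be the image of a clique, but its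
    line with \<open>D'\<close> is covered. A second point \<open>z\<close> of this line lifts to
    \<open>D\<close>, and the member of \<open>S\<close> through \<open>x\<close> and the lifted
    point must be mapped onto \<open>C'\<close>.\<close>
  obtain z where z: "z \<in> C'" "z \<in> D'" "z \<noteq> f x"
    using line_other_point[of C' D' "f x"] C' D' D by blast
  then obtain z' where z': "z' \<in> D" "z = f z'" using D' by blast
  then have "adj x z'" using adj_in_clique[of D] D z by blast
  then obtain C where C: "C \<in> S" "x \<in> C" "z' \<in> C" using ex_S by blast
  then obtain C'' where C'': "C'' \<in> S" "f ` C = C''" using pS onto_S by metis
  then have "C'' = C'" using unique_S[of C'' C' "f x" z] C C' z z' by blast
  then show "y \<in> f ` V" using C' C'' clique_subset[of C] C by blast
qed

end

context biclique_space
begin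

theorem endo_onto_or_image_in_clique:
  assumes fV: "\<And>x. x \<in> V \<Longrightarrow> f x \<in> V" and fadj: "\<And>x y. adj x y \<Longrightarrow> adj (f x) (f y)"
  shows "f ` V = V \<or> (\<exists>C\<in>S \<union> T. f ` V \<subseteq> C)"
proof (cases "V = {}")
  case True then show ?thesis by simp
next
  case V: False
  interpret F: biclique_endo V adj S T k f
    by unfold_locales (use fV fadj in auto)
  \<comment> \<open>The square is needed when \<open>f\<close> exchanges the kinds: it then
    preserves them, and its surjectivity gives that of \<open>f\<close>.\<close>
  interpret FF: biclique_endo V adj S T k "f \<circ> f"
    by unfold_locales (use fV fadj in auto)
  show ?thesis
  proof (cases "\<exists>C\<in>S. \<exists>D\<in>T. C \<inter> D \<noteq> {} \<and> F.cover C = F.cover D")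
    case True
    then obtain C D x where "C \<in> S" "x \<in> C" "D \<in> T" "x \<in> D" "F.cover C = F.cover D" by auto
    then have "f ` V \<subseteq> F.cover C" "F.cover C \<in> S \<union> T"
      using F.merged_flag_imp_image_in_clique[of C x D] F.cover(1)[of C] by auto
    then show ?thesis by blast
  next
    case False
    then have opp: "F.opposite (F.cover C) (F.cover D)" if "C \<in> S" "D \<in> T" "x \<in> C" "x \<in> D" for C D x
      using F.cover_eq_or_opposite[OF that] that by auto
    obtain x0 where x0: "x0 \<in> V" using V by blast
    then obtain C0 where C0: "C0 \<in> S" "x0 \<in> C0" using two_S by blast
    have cases: "F.cover C0 \<in> S \<or> F.cover C0 \<in> T" using F.cover(1) C0 by blast
    show ?thesis
    proof (cases "F.cover C0 \<in> S")
      case True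
      have hS: "F.cover C \<in> S" if "C \<in> S" "x \<in> C" for C x
        by (rule F.cover_types_constant(1)[of S T, OF _ _ C0 True that]) (simp, erule (3) opp)
      have hT: "F.cover D \<in> T" if "D \<in> T" "x \<in> D" for D x
        by (rule F.cover_types_constant(2)[of S T, OF _ _ C0 True that]) (simp, erule (3) opp)
      have "f ` V = V"
      proof (rule F.surj_if_type_preserving[OF _ _ V])
        show "\<exists>C'\<in>S. f ` C \<subseteq> C'" if "C \<in> S" "x \<in> C" for C x
          using hS[OF that] F.cover(2)[of C] that by blast
        show "\<exists>C'\<in>T. f ` C \<subseteq> C'" if "C \<in> T" "x \<in> C" for C x
          using hT[OF that] F.cover(2)[of C] that by blast
      qed
      then show ?thesis by blast
    next
      case False
      then have T: "F.cover C0 \<in> T" using cases by blast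
      have hS: "F.cover C \<in> T" if "C \<in> S" "x \<in> C" for C x
        by (rule F.cover_types_constant(1)[of T S, OF _ _ C0 T that]) (simp, erule (3) opp)
      have hT: "F.cover D \<in> S" if "D \<in> T" "x \<in> D" for D x
        by (rule F.cover_types_constant(2)[of T S, OF _ _ C0 T that]) (simp, erule (3) opp)
      have ff: "(f \<circ> f) ` C \<subseteq> F.cover (F.cover C)" if "C \<in> S \<union> T" for C
        using F.cover(2)[OF that] F.cover(2)[OF F.cover(1)[OF that]] by fastforce
      \<comment> \<open>\<open>hS\<close> and \<open>hT\<close> ask for a point of the clique;
        \<open>f x\<close> is one in the cover.\<close>
      have ne: "f x \<in> F.cover C" if "x \<in> C" "C \<in> S \<union> T" for x C using F.cover(2) that by blast
      have "(f \<circ> f) ` V = V"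
      proof (rule FF.surj_if_type_preserving[OF _ _ V])
        show "\<exists>C'\<in>S. (f \<circ> f) ` C \<subseteq> C'" if "C \<in> S" "x \<in> C" for C x
          using hT[OF hS[OF that] ne] ff that by blast
        show "\<exists>C'\<in>T. (f \<circ> f) ` C \<subseteq> C'" if "C \<in> T" "x \<in> C" for C x
          using hS[OF hT[OF that] ne] ff that by blast
      qed
      then have "f ` V = V" using fV by (metis image_comp image_mono subset_antisym image_subsetI)
      then show ?thesis by blast
    qed
  qed
qed

end

section \<open>Stars and tops of subspaces\<close>

context finite_dimensional_vector_space
begin

lemma dim_span_Un_Int:
  assumes "subspace A" "subspace B"
  shows "dim (span (A \<union> B)) + dim (A \<inter> B) = dim A + dim B"
proof -
  have "span A = A" "span B = B" using assms by auto
  then show ?thesis using dim_sums_Int[OF assms] by (simp only: span_Un)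
qed

lemma dim_span_insert_notin:
  assumes "subspace P" "x \<notin> P" shows "dim (span (insert x P)) = dim P + 1"
proof -
  have "span P = P" using assms by simp
  then show ?thesis using assms by (simp only: dim_span dim_insert) simp
qed

lemma subspace_eqI:
  assumes "subspace A" "subspace B" "A \<subseteq> B" "dim B \<le> dim A" shows "A = B"
  using assms subspace_dim_equal by blast

lemma intermediate_subspace:
  assumes "subspace P" "subspace Q" "P \<subseteq> Q" "dim P \<le> d" "d \<le> dim Q"
  obtains Z where "subspace Z" "P \<subseteq> Z" "Z \<subseteq> Q" "dim Z = d"
proof -
  have "\<exists>Z. subspace Z \<and> P \<subseteq> Z \<and> Z \<subseteq> Q \<and> dim Z = d"
    using assms(4,5)
  proof (induction d rule: dec_induct)
    case base
    then show ?case using assms by blast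
  next
    case (step d)
    then obtain Z where Z: "subspace Z" "P \<subseteq> Z" "Z \<subseteq> Q" "dim Z = d" by auto
    then have "Z \<noteq> Q" using step by auto
    then obtain x where x: "x \<in> Q" "x \<notin> Z" using Z by blast
    have "span (insert x Z) \<subseteq> Q" using x Z assms by (intro span_minimal) auto
    moreover have "P \<subseteq> span (insert x Z)" using Z span_superset by blast
    moreover have "dim (span (insert x Z)) = Suc d" using dim_span_insert_notin[OF Z(1) x(2)] Z
      by simp
    ultimately show ?case using subspace_span by blast
  qed
  then show ?thesis using that by blast
qed

text \<open>Modulo \<open>P\<close>, two independent vectors \<open>x\<close>, \<open>y\<close> and
  their sum \<open>x + y\<close> span three different lines. This holds over every field, including
  the one with two elements.\<close>

lemma three_intermediate_subspaces:
  assumes P: "subspace P" and Q: "subspace Q" "P \<subseteq> Q" "dim P + 2 \<le> dim Q"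
  obtains X Y Z where "subspace X" "subspace Y" "subspace Z"
    "P \<subseteq> X" "P \<subseteq> Y" "P \<subseteq> Z" "X \<subseteq> Q" "Y \<subseteq> Q" "Z \<subseteq> Q"
    "dim X = dim P + 1" "dim Y = dim P + 1" "dim Z = dim P + 1"
    "X \<noteq> Y" "X \<noteq> Z" "Y \<noteq> Z"
proof -
  have sP: "span P = P" using P by simp
  have "P \<noteq> Q" using Q by auto
  then obtain x where x: "x \<in> Q" "x \<notin> P" using Q by blast
  have "span (insert x P) \<noteq> Q" using dim_span_insert_notin[OF P x(2)] Q by auto
  moreover have "span (insert x P) \<subseteq> Q" using x Q by (intro span_minimal) auto
  ultimately obtain y where y: "y \<in> Q" "y \<notin> span (insert x P)" by blast
  have yP: "y \<notin> P" using y span_superset by blast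
  have xin: "x \<in> span (insert x P)" "y \<in> span (insert y P)" "x + y \<in> span (insert (x + y) P)"
    by (auto intro: span_base)
  have ny: "x + y \<notin> span (insert x P)" using y xin span_add_eq by blast
  have nx: "x \<notin> span (insert y P)" using in_span_insert[of x y P] x y sP by auto
  then have nx': "x + y \<notin> span (insert y P)" using xin span_add_eq2 by blast
  have xyP: "x + y \<notin> P" using ny span_superset by blast
  have xyQ: "x + y \<in> Q" using x y Q subspace_add by blast
  show ?thesis
  proof (rule that[of "span (insert x P)" "span (insert y P)" "span (insert (x + y) P)"])
    show "span (insert x P) \<subseteq> Q" "span (insert y P) \<subseteq> Q" "span (insert (x + y) P) \<subseteq> Q"
      using x y xyQ Q by (simp_all add: span_minimal)
    show "P \<subseteq> span (insert x P)" "P \<subseteq> span (insert y P)" "P \<subseteq> span (insert (x + y) P)"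
      using span_superset by blast+
    show "span (insert x P) \<noteq> span (insert y P)" "span (insert x P) \<noteq> span (insert (x + y) P)"
      "span (insert y P) \<noteq> span (insert (x + y) P)"
      using xin y ny nx' by auto
  qed (auto simp: dim_span_insert_notin P x yP xyP simp del: dim_span)
qed

text \<open>They are found between \<open>Q\<close> and a subspace of codimension two.\<close>

lemma three_hyperplanes:
  assumes Q: "subspace Q" "2 \<le> dim Q"
  obtains X Y Z where "subspace X" "subspace Y" "subspace Z" "X \<subseteq> Q" "Y \<subseteq> Q" "Z \<subseteq> Q"
    "dim X + 1 = dim Q" "dim Y + 1 = dim Q" "dim Z + 1 = dim Q"
    "X \<noteq> Y" "X \<noteq> Z" "Y \<noteq> Z"
proof -
  obtain P where P: "subspace P" "P \<subseteq> Q" "dim P = dim Q - 2"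
    using intermediate_subspace[of "{0}" Q "dim Q - 2"] Q subspace_0 by auto
  show ?thesis
    by (rule three_intermediate_subspaces[OF P(1) Q(1) P(2)]) (use P Q that in auto)
qed

text \<open>Distinct spaces of equal dimension meet in a smaller one, so by the dimension formula
  their span exceeds \<open>A\<close> and fills \<open>Z\<close>.\<close>

lemma span_two_hyperplanes:
  assumes "subspace A" "subspace B" "subspace Z" "A \<subseteq> Z" "B \<subseteq> Z" "A \<noteq> B"
    "dim A + 1 = dim Z" "dim B = dim A"
  shows "span (A \<union> B) = Z"
proof (rule subspace_eqI)
  show "span (A \<union> B) \<subseteq> Z" using assms by (intro span_minimal) auto
  have "dim (A \<inter> B) < dim A"
    using subspace_eqI[of "A \<inter> B" A] subspace_eqI[of A B] assms
    by (metis inf_le1 inf_le2 le_refl not_less subspace_inter subset_antisym)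
  then show "dim Z \<le> dim (span (A \<union> B))" using dim_span_Un_Int[of A B] assms by linarith
qed (use assms in auto)

section \<open>Intervals of subspaces and their sizes\<close>

text \<open>One notion for all the sets to be counted: a star has \<open>Q = UNIV\<close>, a top has
  \<open>P = {0}\<close>, a line has both bounds proper, and the whole vertex set has
  \<open>{0}\<close> and \<open>UNIV\<close>.\<close>

definition interval :: "nat \<Rightarrow> 'b set \<Rightarrow> 'b set \<Rightarrow> 'b set set" where
  "interval d P Q = {Z. subspace Z \<and> dim Z = d \<and> P \<subseteq> Z \<and> Z \<subseteq> Q}"

lemma finite_interval:
  assumes "finite (UNIV :: 'b set)" shows "finite (interval d P Q)"
proof -
  have "finite (Pow (UNIV :: 'b set))" using assms by (simp only: finite_Pow_iff)
  then show ?thesis by (rule finite_subset[rotated]) simp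
qed

text \<open>Each flag has a basis of \<open>Q\<close> extending a basis of \<open>P\<close>. A
  bijection between two such bases, assembled from one on the smaller bases and one on the
  complements, extends to an injective linear map.\<close>

lemma flag_transitive:
  assumes "subspace P" "subspace Q" "P \<subseteq> Q" "subspace P'" "subspace Q'" "P' \<subseteq> Q'"
    and "dim P = dim P'" "dim Q = dim Q'"
  obtains g where "Vector_Spaces.linear scale scale g" "inj g" "g ` P = P'" "g ` Q = Q'"
proof -
  have basis: "\<exists>B C. B \<subseteq> C \<and> independent C \<and> span B = P \<and> span C = Q"
    if PQ: "subspace P" "subspace Q" "P \<subseteq> Q" for P Q
  proof -
    obtain B where B: "B \<subseteq> P" "independent B" "P \<subseteq> span B"
      by (rule maximal_independent_subset)
    obtain C where C: "B \<subseteq> C" "C \<subseteq> Q" "independent C" "Q \<subseteq> span C"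
      using maximal_independent_subset_extend[of B Q] B PQ by blast
    have "span B = P" using B PQ span_subspace by blast
    moreover have "span C = Q" using C PQ span_subspace by blast
    ultimately show ?thesis using C by blast
  qed
  obtain B C where BC: "B \<subseteq> C" "independent C" "span B = P" "span C = Q"
    using basis[OF assms(1-3)] by blast
  obtain B' C' where BC': "B' \<subseteq> C'" "independent C'" "span B' = P'" "span C' = Q'"
    using basis[OF assms(4-6)] by blast
  have fin: "finite C" "finite C'" using BC BC' finiteI_independent by auto
  have ind: "independent B" "independent B'" using BC BC' independent_mono by blast+
  have card: "card B = card B'" "card C = card C'"
    using assms(7,8) BC BC' ind dim_span_eq_card_independent by metis+
  obtain h1 where h1: "bij_betw h1 B B'"
    using card fin BC BC' finite_same_card_bij finite_subset by metis
  have "card (C - B) = card (C' - B')"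
    using card fin BC BC' by (simp add: card_Diff_subset finite_subset)
  then obtain h2 where h2: "bij_betw h2 (C - B) (C' - B')"
    using fin finite_same_card_bij by blast
  define h where "h x = (if x \<in> B then h1 x else h2 x)" for x
  have hB: "bij_betw h B B'"
    by (rule bij_betw_cong[THEN iffD2, OF _ h1]) (auto simp: h_def)
  have hCB: "bij_betw h (C - B) (C' - B')"
    by (rule bij_betw_cong[THEN iffD2, OF _ h2]) (auto simp: h_def)
  have "bij_betw h (B \<union> (C - B)) (B' \<union> (C' - B'))"
    by (rule bij_betw_combine[OF hB hCB]) auto
  then have hC: "bij_betw h C C'" using BC BC' by (simp add: Un_absorb1)
  obtain g where g: "Vector_Spaces.linear scale scale g" "inj g" "\<forall>x\<in>C. g x = h x"
    using linear_independent_extend_inj[of C h] BC BC' hC by (auto simp: bij_betw_def)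
  interpret g: Vector_Spaces.linear scale scale g by fact
  have "g ` B = h ` B" using g(3) BC(1) by (intro image_cong) auto
  then have "g ` B = B'" using hB by (simp add: bij_betw_def)
  then have "g ` P = P'" using g.span_image[of B] BC BC' by simp
  moreover have "g ` C = C'" using g hC by (auto simp: bij_betw_def)
  then have "g ` Q = Q'" using g.span_image[of C] BC BC' by simp
  ultimately show ?thesis using g that by blast
qed

text \<open>An injective linear map carrying one flag to the other preserves dimension and
  inclusion, hence embeds one interval in the other; exchanging the flags gives the reverse
  inequality.\<close>

lemma card_interval_eq:
  assumes fin: "finite (UNIV :: 'b set)"
    and "subspace P" "subspace Q" "P \<subseteq> Q" "subspace P'" "subspace Q'" "P' \<subseteq> Q'"
    and "dim P = dim P'" "dim Q = dim Q'"
  shows "card (interval d P Q) = card (interval d P' Q')"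
proof -
  have le: "card (interval d P Q) \<le> card (interval d P' Q')"
    if *: "subspace P" "subspace Q" "P \<subseteq> Q" "subspace P'" "subspace Q'" "P' \<subseteq> Q'"
      "dim P = dim P'" "dim Q = dim Q'" for P Q P' Q'
  proof -
    obtain g where g: "Vector_Spaces.linear scale scale g" "inj g" "g ` P = P'" "g ` Q = Q'"
      using flag_transitive[OF *] .
    interpret g: Vector_Spaces.linear scale scale g by fact
    interpret finite_dimensional_vector_space_pair_1 scale Basis scale ..
    have "(`) g ` interval d P Q \<subseteq> interval d P' Q'"
    proof (rule image_subsetI)
      fix Z assume Z: "Z \<in> interval d P Q"
      then have "dim (g ` Z) = d"
        using dim_image_eq[OF g(1), of Z] inj_on_subset[OF g(2)] by (simp add: interval_def)
      then show "g ` Z \<in> interval d P' Q'"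
        using Z g by (auto simp: interval_def intro: g.subspace_image)
    qed
    moreover have "inj_on ((`) g) (interval d P Q)" using g(2)
      by (simp add: inj_on_def inj_image_eq_iff)
    moreover have "finite (interval d P' Q')" using fin by (rule finite_interval)
    ultimately show ?thesis using card_inj_on_le by blast
  qed
  show ?thesis
    using le[OF assms(2-9)] le[OF assms(5-7,2-4) assms(8,9)[symmetric]] by (rule antisym)
qed

section \<open>Adjacency, cliques and connectedness of the Grassmann graph\<close>

text \<open>This makes stars cliques: the intersection contains \<open>P\<close>, and it is smaller
  than \<open>X\<close> because \<open>X \<noteq> Y\<close>.\<close>

lemma adj_if_common_hyperplane:
  assumes "subspace X" "subspace Y" "dim X = m" "dim Y = m" "X \<noteq> Y"
    "P \<subseteq> X" "P \<subseteq> Y" "dim P + 1 = m"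
  shows "dim (X \<inter> Y) + 1 = m"
proof -
  have "dim P \<le> dim (X \<inter> Y)" using assms by (intro dim_subset) auto
  moreover have "dim (X \<inter> Y) < m"
    using subspace_eqI[of "X \<inter> Y" X] subspace_eqI[of X Y] assms
    by (metis inf_le1 inf_le2 le_refl not_less subspace_inter)
  ultimately show ?thesis using assms by simp
qed

text \<open>The dual fact, making tops cliques: the two spaces span \<open>Q\<close>, and the
  dimension formula gives their intersection.\<close>

lemma adj_if_common_cover:
  assumes "subspace X" "subspace Y" "dim X = m" "dim Y = m" "X \<noteq> Y"
    "X \<subseteq> Q" "Y \<subseteq> Q" "subspace Q" "dim Q = m + 1"
  shows "dim (X \<inter> Y) + 1 = m"
proof -
  have "span (X \<union> Y) = Q" using assms by (intro span_two_hyperplanes) auto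
  then show ?thesis using dim_span_Un_Int[of X Y] assms by simp
qed

lemma dim_cover: 
  assumes "subspace X" "subspace Y" "dim X = m" "dim Y = m" "dim (X \<inter> Y) + 1 = m"
  shows "dim (span (X \<union> Y)) = m + 1"
  using dim_span_Un_Int[of X Y] assms by simp

definition grassmann_adj :: "nat \<Rightarrow> 'b set \<Rightarrow> 'b set \<Rightarrow> bool" where
  "grassmann_adj m X Y \<longleftrightarrow> (X, Y) \<in> parcs (grassmann_graph m)"

lemma grassmann_adj_iff:
  "grassmann_adj m X Y \<longleftrightarrow> subspace X \<and> dim X = m \<and> subspace Y \<and> dim Y = m \<and> dim (X \<inter> Y) + 1 = m"
  by (simp add: grassmann_adj_def grassmann_graph_def)

text \<open>The hyperplanes \<open>X \<inter> Z\<close> and \<open>Y \<inter> Z\<close> of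
  \<open>Z\<close> differ, as otherwise they would equal \<open>X \<inter> Y\<close>. Hence they
  span \<open>Z\<close>.\<close>

lemma grassmann_adj_triple:
  assumes adj: "grassmann_adj m X Y" "grassmann_adj m X Z" "grassmann_adj m Y Z"
    and n: "\<not> X \<inter> Y \<subseteq> Z"
  shows "Z \<subseteq> span (X \<union> Y)"
proof -
  have s: "subspace X" "subspace Y" "subspace Z" "dim Z = m"
    and d: "dim (X \<inter> Y) + 1 = m" "dim (X \<inter> Z) + 1 = m" "dim (Y \<inter> Z) + 1 = m"
    using adj by (auto simp: grassmann_adj_iff)
  have "X \<inter> Z \<noteq> Y \<inter> Z"
  proof
    assume "X \<inter> Z = Y \<inter> Z"
    then have "X \<inter> Z = X \<inter> Y" using s d by (intro subspace_eqI subspace_inter) auto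
    then show False using n by auto
  qed
  then have "span ((X \<inter> Z) \<union> (Y \<inter> Z)) = Z"
    using s d by (intro span_two_hyperplanes subspace_inter) auto
  moreover have "span ((X \<inter> Z) \<union> (Y \<inter> Z)) \<subseteq> span (X \<union> Y)" by (intro span_mono) auto
  ultimately show ?thesis by simp
qed

text \<open>For distinct \<open>X\<close>, \<open>Y\<close> in \<open>K\<close>, either every member
  contains \<open>X \<inter> Y\<close>, or some \<open>Z\<close> does not. In the second case
  \<open>Z\<close> lies in \<open>span (X \<union> Y)\<close>, and every other member is forced into
  it as well.\<close>

lemma clique_in_star_or_top:
  assumes m: "1 \<le> m" "m < dim UNIV" and K: "\<And>X. X \<in> K \<Longrightarrow> subspace X \<and> dim X = m"
    and adj: "\<And>X Y. X \<in> K \<Longrightarrow> Y \<in> K \<Longrightarrow> X \<noteq> Y \<Longrightarrow> grassmann_adj m X Y"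
  shows "(\<exists>P. subspace P \<and> dim P + 1 = m \<and> K \<subseteq> interval m P UNIV) \<or>
         (\<exists>Q. subspace Q \<and> dim Q = m + 1 \<and> K \<subseteq> interval m {0} Q)"
proof (cases "\<exists>X\<in>K. \<exists>Y\<in>K. X \<noteq> Y")
  case False
  \<comment> \<open>A clique with at most one vertex is enlarged to a singleton; the empty one gets
    an arbitrary \<open>m\<close>-space. Any hyperplane of \<open>X\<close> then serves as the
    centre of a star.\<close>
  obtain X where X: "subspace X" "dim X = m" "K \<subseteq> {X}"
  proof (cases "K = {}")
    case True
    then show ?thesis using intermediate_subspace[of "{0}" UNIV m] m that by auto
  next
    case False
    then obtain X where "X \<in> K" by blast
    moreover from this have "K \<subseteq> {X}" using \<open>\<not> (\<exists>X\<in>K. \<exists>Y\<in>K. X \<noteq> Y)\<close> by auto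
    ultimately show ?thesis using that K by metis
  qed
  obtain P where "subspace P" "P \<subseteq> X" "dim P = m - 1"
    using intermediate_subspace[of "{0}" X "m - 1"] X subspace_0 by auto
  then show ?thesis using X m by (intro disjI1 exI[of _ P]) (auto simp: interval_def)
next
  case True
  then obtain X Y where XY: "X \<in> K" "Y \<in> K" "X \<noteq> Y" by blast
  have XYa: "grassmann_adj m X Y" using adj XY by blast
  show ?thesis
  proof (cases "\<forall>Z\<in>K. X \<inter> Y \<subseteq> Z")
    case True
    then show ?thesis using XYa K
      by (intro disjI1 exI[of _
        "X \<inter> Y"]) (auto simp: interval_def grassmann_adj_iff intro: subspace_inter)
  next
    case False
    then obtain Z where Z: "Z \<in> K" "\<not> X \<inter> Y \<subseteq> Z" by blast
    then have ZXY: "grassmann_adj m X Z" "grassmann_adj m Y Z" using adj XY by auto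
    have ZQ: "Z \<subseteq> span (X \<union> Y)" using grassmann_adj_triple[OF XYa ZXY Z(2)] .
    have "W \<subseteq> span (X \<union> Y)" if W: "W \<in> K" for W
    proof (cases "W = X \<or> W = Y \<or> W = Z")
      case True
      then show ?thesis using ZQ span_superset[of "X \<union> Y"] by auto
    next
      case F: False
      then have a: "grassmann_adj m X W" "grassmann_adj m Y W" "grassmann_adj m Z W"
        using adj XY Z W by auto
      consider "\<not> X \<inter> Y \<subseteq> W" | "\<not> X \<inter> Z \<subseteq> W" | "X \<inter> Y \<subseteq> W" "X \<inter> Z \<subseteq> W" by blast
      then show ?thesis
      proof cases
        case 1
        then show ?thesis using grassmann_adj_triple[OF XYa a(1,2)] by blast
      next
        case 2
        then have "W \<subseteq> span (X \<union> Z)" using grassmann_adj_triple[OF ZXY(1) a(1,3)] by blast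
        moreover have "span (X \<union> Z) \<subseteq> span (X \<union> Y)"
          using ZQ span_superset[of "X \<union> Y"] by (intro span_minimal) auto
        ultimately show ?thesis by blast
      next
        case 3
        \<comment> \<open>Since \<open>Z\<close> does not contain \<open>X \<inter> Y\<close>, these
          are distinct hyperplanes of \<open>X\<close>. Containing both would make \<open>W\<close>
          equal to \<open>X\<close>.\<close>
        have "span ((X \<inter> Y) \<union> (X \<inter> Z)) = X"
          using XYa ZXY Z by (intro span_two_hyperplanes subspace_inter) (auto simp: grassmann_adj_iff)
        moreover have "span ((X \<inter> Y) \<union> (X \<inter> Z)) \<subseteq> W"
          using 3 a by (intro span_minimal) (auto simp: grassmann_adj_iff)
        ultimately have "X = W" using a by (intro subspace_eqI) (auto simp: grassmann_adj_iff)
        then show ?thesis using F by blast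
      qed
    qed
    moreover have "dim (span (X \<union> Y)) = m + 1" using XYa
      by (intro dim_cover) (auto simp: grassmann_adj_iff)
    ultimately show ?thesis using K subspace_0
      by (intro disjI2 exI[of _ "span (X \<union> Y)"]) (auto simp: interval_def simp del: dim_span)
  qed
qed

text \<open>Induction on the codimension of \<open>X \<inter> Y\<close> in \<open>X\<close>. A
  hyperplane \<open>H\<close> of \<open>X\<close> above \<open>X \<inter> Y\<close> together with a
  vector of \<open>Y\<close> outside \<open>X\<close> spans a neighbour of \<open>X\<close> that
  meets \<open>Y\<close> in a larger space.\<close>

lemma grassmann_connected:
  assumes W: "\<And>X Y. X \<in> W \<Longrightarrow> grassmann_adj m X Y \<Longrightarrow> Y \<in> W" and X: "X \<in> W" "subspace X" "dim X = m"
    and Y: "subspace Y" "dim Y = m"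
  shows "Y \<in> W"
  using X
proof (induction "m - dim (X \<inter> Y)" arbitrary: X rule: less_induct)
  case less
  show ?case
  proof (cases "X = Y")
    case True then show ?thesis using less by simp
  next
    case False
    then have "\<not> Y \<subseteq> X" using subspace_eqI[of Y X] less Y by auto
    then obtain y where y: "y \<in> Y" "y \<notin> X" by blast
    have "X \<inter> Y \<noteq> X" using subspace_eqI[of X Y] less Y False by auto
    then have lt: "dim (X \<inter> Y) < m"
      using subspace_eqI[of "X \<inter> Y" X] less Y subspace_inter by (metis inf_le1 not_less)
    obtain H where H: "subspace H" "X \<inter> Y \<subseteq> H" "H \<subseteq> X" "dim H = m - 1"
      by (rule intermediate_subspace[of "X \<inter> Y" X "m - 1"])
        (use less.prems Y lt subspace_inter[of X Y] in auto)
    define X' where "X' = span (insert y H)"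
    have yH: "y \<notin> H" using y H by blast
    have X': "subspace X'" "dim X' = m" "y \<in> X'" "H \<subseteq> X'"
      using dim_span_insert_notin[OF H(1) yH] H lt span_superset[of "insert y H"]
      by (auto simp: X'_def simp del: dim_span)
    have "dim (X \<inter> X') + 1 = m"
      by (rule adj_if_common_hyperplane[where P = H]) (use X' y H lt less in auto)
    then have "X' \<in> W" using W[of X X'] less X' by (auto simp: grassmann_adj_iff)
    have "insert y (X \<inter> Y) \<subseteq> X' \<inter> Y" using X' H y by auto
    then have "dim (span (insert y (X \<inter> Y))) \<le> dim (X' \<inter> Y)" by (simp add: dim_subset)
    then have "dim (X \<inter> Y) < dim (X' \<inter> Y)"
      using dim_span_insert_notin[of "X \<inter> Y" y] less Y y subspace_inter by auto
    then show ?thesis using less(1)[of X'] X' \<open>X' \<in> W\<close> lt by auto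
  qed
qed

lemma grassmann_pverts: "X \<in> pverts (grassmann_graph m) \<longleftrightarrow> subspace X \<and> dim X = m"
  by (simp add: grassmann_graph_def)

lemma in_star: "X \<in> interval m P UNIV \<longleftrightarrow> subspace X \<and> dim X = m \<and> P \<subseteq> X"
  by (simp add: interval_def)

lemma in_top: "X \<in> interval m {0} Q \<longleftrightarrow> subspace X \<and> dim X = m \<and> X \<subseteq> Q"
  using subspace_0 by (auto simp: interval_def)

section \<open>Stars and tops as an instance of the abstract clique structure\<close>

text \<open>The centre is recovered as the intersection of two members; the bound on
  \<open>m\<close> ensures that there are two. This turns distinct centres through a vertex into
  distinct cliques.\<close>

lemma star_inject:
  assumes "subspace P" "subspace P'" "dim P + 1 = m" "dim P' + 1 = m" "m + 1 \<le> dim UNIV"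
    and eq: "interval m P UNIV = interval m P' UNIV"
  shows "P = P'"
proof -
  obtain X Y where X: "subspace X" "P \<subseteq> X" "dim X = dim P + 1"
    and Y: "subspace Y" "P \<subseteq> Y" "dim Y = dim P + 1" and ne: "X \<noteq> Y"
    by (rule three_intermediate_subspaces[of P UNIV]) (use assms in auto)
  have "X \<in> interval m P UNIV" "Y \<in> interval m P UNIV" using X Y assms(3) by (auto simp: in_star)
  then have sub: "P' \<subseteq> X \<inter> Y" using eq by (auto simp: in_star)
  have d: "dim (X \<inter> Y) + 1 = m"
    by (rule adj_if_common_hyperplane[of X Y m P]) (use X Y ne assms in auto)
  have "P = X \<inter> Y" "P' = X \<inter> Y"
    using X Y d sub assms by (intro subspace_eqI subspace_inter; auto)+
  then show ?thesis by simp
qed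

text \<open>Dually, \<open>Q\<close> is the span of two distinct members.\<close>

lemma top_inject:
  assumes "subspace Q" "subspace Q'" "dim Q = m + 1" "dim Q' = m + 1" "1 \<le> m"
    and eq: "interval m {0} Q = interval m {0} Q'"
  shows "Q = Q'"
proof -
  obtain X Y where X: "subspace X" "X \<subseteq> Q" "dim X + 1 = dim Q"
    and Y: "subspace Y" "Y \<subseteq> Q" "dim Y + 1 = dim Q" and ne: "X \<noteq> Y"
    by (rule three_hyperplanes[of Q]) (use assms in auto)
  have "X \<in> interval m {0} Q" "Y \<in> interval m {0} Q" using X Y assms(3) by (auto simp: in_top)
  then have sub: "X \<subseteq> Q'" "Y \<subseteq> Q'" using eq by (auto simp: in_top)
  have "span (X \<union> Y) = Q" "span (X \<union> Y) = Q'"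
    using X Y sub ne assms by (intro span_two_hyperplanes; simp)+
  then show ?thesis by simp
qed

definition stars :: "nat \<Rightarrow> 'b set set set" where
  "stars m = {interval m P UNIV |P. subspace P \<and> dim P + 1 = m}"

definition tops :: "nat \<Rightarrow> 'b set set set" where
  "tops m = {interval m {0} Q |Q. subspace Q \<and> dim Q = m + 1}"

text \<open>The number \<open>k\<close> is the size of one sample line, the interval between
  \<open>P0\<close> and \<open>Q0\<close>; flag transitivity transfers it to all others.\<close>

lemma card_star_Int_top:
  assumes fin: "finite (UNIV :: 'b set)" and m: "2 \<le> m" "m + 2 \<le> dim UNIV"
  obtains k where "2 \<le> k"
    and "\<And>C D. C \<in> stars m \<Longrightarrow> D \<in> tops m \<Longrightarrow> C \<inter> D \<noteq> {} \<Longrightarrow> card (C \<inter> D) = k"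
proof -
  obtain P0 where P0: "subspace P0" "dim P0 = m - 1"
    by (rule intermediate_subspace[of "{0}" UNIV "m - 1"]) (use m in auto)
  obtain Q0 where Q0: "subspace Q0" "P0 \<subseteq> Q0" "dim Q0 = m + 1"
    by (rule intermediate_subspace[of P0 UNIV "m + 1"]) (use m P0 in auto)
  obtain X Y where X: "subspace X" "P0 \<subseteq> X" "X \<subseteq> Q0" "dim X = dim P0 + 1"
    and Y: "subspace Y" "P0 \<subseteq> Y" "Y \<subseteq> Q0" "dim Y = dim P0 + 1" and ne: "X \<noteq> Y"
    by (rule three_intermediate_subspaces[of P0 Q0]) (use P0 Q0 m in auto)
  have "{X, Y} \<subseteq> interval m P0 Q0" using X Y P0 m by (auto simp: interval_def)
  then have "card {X, Y} \<le> card (interval m P0 Q0)" by (intro card_mono finite_interval fin)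
  then have k: "2 \<le> card (interval m P0 Q0)" using ne by simp
  have "card (C \<inter> D) = card (interval m P0 Q0)"
    if CD: "C \<in> stars m" "D \<in> tops m" "C \<inter> D \<noteq> {}" for C D
  proof -
    obtain P Q where P: "subspace P" "dim P + 1 = m" "C = interval m P UNIV"
      and Q: "subspace Q" "dim Q = m + 1" "D = interval m {0} Q"
      using CD by (auto simp: stars_def tops_def)
    \<comment> \<open>A common vertex lies between the centre of the star and the bound of the top,
      so \<open>P \<subseteq> Q\<close> and the intersection is an interval.\<close>
    obtain Z where "Z \<in> C" "Z \<in> D" using CD(3) by blast
    then have "P \<subseteq> Z" "Z \<subseteq> Q" using P Q by (auto simp: in_star in_top)
    then have "P \<subseteq> Q" by blast
    moreover have "C \<inter> D = interval m P Q" using P Q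
      by (auto simp: in_star in_top) (auto simp: interval_def)
    ultimately show ?thesis
      using card_interval_eq[OF fin P(1) Q(1) _ P0(1) Q0(1) Q0(2)] P Q P0 Q0 m by auto
  qed
  then show ?thesis using k that by blast
qed

text \<open>Both bounds on \<open>m\<close> enter: dimension at least two gives a vertex several
  hyperplanes, hence several stars, and codimension at least two gives it three tops.\<close>

lemma biclique_space_grassmann:
  assumes fin: "finite (UNIV :: 'b set)" and m: "2 \<le> m" "m + 2 \<le> dim UNIV"
  obtains k where "biclique_space (pverts (grassmann_graph m)) (grassmann_adj m) (stars m) (tops m) k"
proof -
  obtain k where k: "2 \<le> k"
    "\<And>C D. C \<in> stars m \<Longrightarrow> D \<in> tops m \<Longrightarrow> C \<inter> D \<noteq> {} \<Longrightarrow> card (C \<inter> D) = k"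
    using card_star_Int_top[OF assms] by blast
  have "biclique_space (pverts (grassmann_graph m)) (grassmann_adj m) (stars m) (tops m) k"
  proof
    have "pverts (grassmann_graph m) = interval m {0} UNIV" by (auto simp: grassmann_pverts in_top)
    then show "finite (pverts (grassmann_graph m))" using finite_interval[OF fin] by simp
    show "C \<subseteq> pverts (grassmann_graph m)" if "C \<in> stars m \<union> tops m" for C
      using that by (auto simp: stars_def tops_def in_star in_top grassmann_pverts)
    show "X \<noteq> Y" if "grassmann_adj m X Y" for X Y
      using that by (auto simp: grassmann_adj_iff)
    show "grassmann_adj m X Y" if "C \<in> stars m \<union> tops m" "X \<in> C" "Y \<in> C" "X \<noteq> Y" for C X Y
      using that adj_if_common_hyperplane[of X Y m] adj_if_common_cover[of X Y m]
      by (auto simp: stars_def tops_def in_star in_top grassmann_adj_iff)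
    show "\<exists>C\<in>stars m. X \<in> C \<and> Y \<in> C" if "grassmann_adj m X Y" for X Y
      using that subspace_inter[of X Y]
      by (intro bexI[of _ "interval m (X \<inter> Y) UNIV"]) (auto simp: stars_def in_star grassmann_adj_iff)
    show "\<exists>D\<in>tops m. X \<in> D \<and> Y \<in> D" if "grassmann_adj m X Y" for X Y
    proof -
      have "dim (span (X \<union> Y)) = m + 1" using that
        by (intro dim_cover) (auto simp: grassmann_adj_iff)
      then have "interval m {0} (span (X \<union> Y)) \<in> tops m" unfolding tops_def by blast
      moreover have "X \<union> Y \<subseteq> span (X \<union> Y)" by (rule span_superset)
      ultimately show ?thesis using that
        by (intro bexI[of _ "interval m {0} (span (X \<union> Y))"]) (auto simp: in_top grassmann_adj_iff)
    qed
    show "C = C'" if C: "C \<in> stars m" "C' \<in> stars m" and X: "X \<in> C \<inter> C'" and Y: "Y \<in> C \<inter> C'"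
      and ne: "X \<noteq> Y"
      for C C' X Y
    proof -
      obtain P P' where P: "subspace P" "dim P + 1 = m" "C = interval m P UNIV"
        and P': "subspace P'" "dim P' + 1 = m" "C' = interval m P' UNIV"
        using C by (auto simp: stars_def)
      have d: "dim (X \<inter> Y) + 1 = m"
        by (rule adj_if_common_hyperplane[of X Y m P]) (use X Y P ne in \<open>auto simp: in_star\<close>)
      \<comment> \<open>Both centres lie in \<open>X \<inter> Y\<close> and have its
        dimension.\<close>
      have "P = X \<inter> Y" "P' = X \<inter> Y"
        using X Y d P P' by (intro subspace_eqI subspace_inter; auto simp: in_star)+
      then show ?thesis using P P' by simp
    qed
    show "D = D'" if D: "D \<in> tops m" "D' \<in> tops m" and X: "X \<in> D \<inter> D'" and Y: "Y \<in> D \<inter> D'"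
      and ne: "X \<noteq> Y"
      for D D' X Y
    proof -
      obtain Q Q' where Q: "subspace Q" "dim Q = m + 1" "D = interval m {0} Q"
        and Q': "subspace Q'" "dim Q' = m + 1" "D' = interval m {0} Q'"
        using D by (auto simp: tops_def)
      have "span (X \<union> Y) = Q" "span (X \<union> Y) = Q'"
        using X Y ne Q Q' by (intro span_two_hyperplanes; simp add: in_top)+
      then show ?thesis using Q Q' by simp
    qed
    show "\<exists>C\<in>stars m \<union> tops m. K \<subseteq> C"
      if "K \<subseteq> pverts (grassmann_graph m)" "\<And>X Y. X \<in> K \<Longrightarrow> Y \<in> K \<Longrightarrow> X \<noteq> Y \<Longrightarrow> grassmann_adj m X Y" for K
    proof -
      have "subspace X \<and> dim X = m" if "X \<in> K" for X using that \<open>K \<subseteq> _\<close> grassmann_pverts by blast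
      then have "(\<exists>P. subspace P \<and> dim P + 1 = m \<and> K \<subseteq> interval m P UNIV) \<or>
          (\<exists>Q. subspace Q \<and> dim Q = m + 1 \<and> K \<subseteq> interval m {0} Q)"
        using m that(2) by (intro clique_in_star_or_top) auto
      then show ?thesis unfolding stars_def tops_def by blast
    qed
    show "2 \<le> k" by fact
    show "card (C \<inter> D) = k" if "C \<in> stars m" "D \<in> tops m" "C \<inter> D \<noteq> {}" for C D
      using k(2) that .
    show "card C = card C'" if C: "C \<in> stars m" "C' \<in> stars m" for C C'
    proof -
      obtain P P' where P: "subspace P" "dim P + 1 = m" "C = interval m P UNIV"
        and P': "subspace P'" "dim P' + 1 = m" "C' = interval m P' UNIV"
        using C by (auto simp: stars_def)
      then show ?thesis using card_interval_eq[OF fin P(1) subspace_UNIV _ P'(1) subspace_UNIV]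
        by simp
    qed
    show "card D = card D'" if D: "D \<in> tops m" "D' \<in> tops m" for D D'
    proof -
      obtain Q Q' where Q: "subspace Q" "dim Q = m + 1" "D = interval m {0} Q"
        and Q': "subspace Q'" "dim Q' = m + 1" "D' = interval m {0} Q'"
        using D by (auto simp: tops_def)
      then show ?thesis
        using card_interval_eq[OF fin subspace_single_0 Q(1) _ subspace_single_0 Q'(1)]
        by (simp add: subspace_0)
    qed
    show "\<exists>C\<in>stars m. \<exists>C'\<in>stars m. C \<noteq> C' \<and> X \<in> C \<and> X \<in> C'"
      if "X \<in> pverts (grassmann_graph m)" for X
    proof -
      have X: "subspace X" "dim X = m" using that by (auto simp: grassmann_pverts)
      obtain P P' where P: "subspace P" "P \<subseteq> X" "dim P + 1 = dim X"
        and P': "subspace P'" "P' \<subseteq> X" "dim P' + 1 = dim X" and ne: "P \<noteq> P'"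
        by (rule three_hyperplanes[of X]) (use X m in auto)
      have "interval m P UNIV \<noteq> interval m P' UNIV"
        using star_inject[of P P' m] P P' ne X m by auto
      then show ?thesis using P P' X
        by (intro bexI[of _ "interval m P UNIV"] bexI[of _
          "interval m P' UNIV"]) (auto simp: stars_def in_star)
    qed
    show "\<exists>D\<in>tops m. \<exists>D'\<in>tops m. \<exists>D''\<in>tops m. D \<noteq> D' \<and> D \<noteq> D'' \<and> D' \<noteq> D'' \<and> X \<in> D \<and> X \<in> D' \<and> X \<in> D''"
      if "X \<in> pverts (grassmann_graph m)" for X
    proof -
      have X: "subspace X" "dim X = m" using that by (auto simp: grassmann_pverts)
      obtain Q Q' Q'' where Q: "subspace Q" "X \<subseteq> Q" "dim Q = dim X + 1"
        and Q': "subspace Q'" "X \<subseteq> Q'" "dim Q' = dim X + 1"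
        and Q'': "subspace Q''" "X \<subseteq> Q''" "dim Q'' = dim X + 1"
        and ne: "Q \<noteq> Q'" "Q \<noteq> Q''" "Q' \<noteq> Q''"
        by (rule three_intermediate_subspaces[of X UNIV]) (use X m in auto)
      have "interval m {0} Q \<noteq> interval m {0} Q'" "interval m {0} Q \<noteq> interval m {0} Q''"
        "interval m {0} Q' \<noteq> interval m {0} Q''"
        using top_inject[of Q Q' m] top_inject[of Q Q'' m] top_inject[of Q' Q'' m] Q Q' Q'' ne X m
        by auto
      moreover have "interval m {0} Q \<in> tops m" "interval m {0} Q' \<in> tops m"
        "interval m {0} Q'' \<in> tops m"
        using Q Q' Q'' X unfolding tops_def by auto
      moreover have "X \<in> interval m {0} Q" "X \<in> interval m {0} Q'" "X \<in> interval m {0} Q''"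
        using Q Q' Q'' X by (auto simp: in_top)
      ultimately show ?thesis by blast
    qed
    show "W = pverts (grassmann_graph m)"
      if W: "W \<subseteq> pverts (grassmann_graph m)" "W \<noteq> {}" "\<And>X Y. X \<in> W \<Longrightarrow> grassmann_adj m X Y \<Longrightarrow> Y \<in> W"
        for W
    proof -
      obtain X where "X \<in> W" "subspace X" "dim X = m" using W(1,2) grassmann_pverts by blast
      then have "Y \<in> W" if "Y \<in> pverts (grassmann_graph m)" for Y
        using grassmann_connected[of W m X Y] W(3) that
        by (auto simp: grassmann_pverts)
      then show ?thesis using W(1) by blast
    qed
  qed
  then show ?thesis by (rule that)
qed

end

section \<open>Automorphisms, colourings and the pseudo-core property\<close>

text \<open>By finiteness \<open>f\<close> is injective on vertices, hence on arcs, hence onto the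
  finite set of arcs. An arc between images therefore comes from an arc.\<close>

lemma onto_endomorphism_imp_automorphism:
  assumes f: "graph_endomorphism G f" and onto: "f ` pverts G = pverts G"
    and fin: "finite (pverts G)"
  shows "graph_automorphism G f"
proof -
  \<comment> \<open>\<open>G\<close> is an arbitrary pre-digraph here, so its arcs are restricted to
    pairs of vertices.\<close>
  let ?E = "parcs G \<inter> pverts G \<times> pverts G"
  have inj: "inj_on f (pverts G)" using onto fin by (simp add: finite_surj_inj eq_card_imp_inj_on)
  have sub: "map_prod f f ` ?E \<subseteq> ?E" using f by (auto simp: graph_endomorphism_def)
  have injE: "inj_on (map_prod f f) ?E"
    by (rule inj_on_subset[OF map_prod_inj_on[OF inj inj]]) auto
  have finE: "finite ?E" using fin by simp
  have ontoE: "map_prod f f ` ?E = ?E" by (rule endo_inj_surj[OF finE sub injE])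
  have "(x, y) \<in> parcs G" if x: "x \<in> pverts G" "y \<in> pverts G" and a: "(f x, f y) \<in> parcs G" for x y
  proof -
    have "(f x, f y) \<in> map_prod f f ` ?E" unfolding ontoE using a x onto by blast
    then obtain x' y' where "(x', y') \<in> ?E" "f x' = f x" "f y' = f y" by force
    then show ?thesis using inj x by (metis IntE SigmaE2 inj_onD)
  qed
  then show ?thesis using f inj onto
    unfolding graph_automorphism_def graph_endomorphism_def bij_betw_def by blast
qed

lemma (in finite_dimensional_vector_space) pseudo_core_grassmann_graph:
  assumes fin: "finite (UNIV :: 'b set)" and m: "1 \<le> m" "m < dim UNIV"
  shows "pseudo_core (grassmann_graph m)"
  unfolding pseudo_core_def
proof (intro allI impI)
  fix f assume f: "graph_endomorphism (grassmann_graph m) f"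
  let ?G = "grassmann_graph m"
  have fV: "f X \<in> pverts ?G" if "X \<in> pverts ?G" for X using f that
    by (auto simp: graph_endomorphism_def)
  have fadj: "grassmann_adj m (f X) (f Y)" if "grassmann_adj m X Y" for X Y
  proof -
    have "X \<in> pverts ?G" "Y \<in> pverts ?G" using that
      by (auto simp: grassmann_adj_iff grassmann_pverts)
    then show ?thesis using f that unfolding graph_endomorphism_def grassmann_adj_def by blast
  qed
  consider "m = 1" | "m + 1 = dim UNIV" | "2 \<le> m" "m + 2 \<le> dim UNIV" using m by linarith
  then show "graph_automorphism ?G f \<or> graph_colouring ?G f"
  proof cases
    case 1
    \<comment> \<open>Distinct lines through the origin share the hyperplane \<open>{0}\<close>, so
      the graph is complete.\<close>
    have "grassmann_adj m X Y" if "X \<in> pverts ?G" "Y \<in> pverts ?G" "X \<noteq> Y" for X Y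
      using that 1 adj_if_common_hyperplane[of X Y m "{0}"]
      by (auto simp: grassmann_adj_iff grassmann_pverts subspace_0)
    then have "graph_colouring ?G f" using f fV
      by (auto simp: graph_colouring_def graph_clique_def grassmann_adj_def)
    then show ?thesis ..
  next
    case 2
    \<comment> \<open>All vertices are hyperplanes of the whole space, so the graph is again
      complete.\<close>
    have "grassmann_adj m X Y" if "X \<in> pverts ?G" "Y \<in> pverts ?G" "X \<noteq> Y" for X Y
      using that 2 adj_if_common_cover[of X Y m UNIV]
      by (auto simp: grassmann_adj_iff grassmann_pverts)
    then have "graph_colouring ?G f" using f fV
      by (auto simp: graph_colouring_def graph_clique_def grassmann_adj_def)
    then show ?thesis ..
  next
    case 3
    obtain k where "biclique_space (pverts ?G) (grassmann_adj m) (stars m) (tops m) k"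
      using biclique_space_grassmann[OF fin 3] .
    then interpret B: biclique_space "pverts ?G" "grassmann_adj m" "stars m" "tops m" k .
    from B.endo_onto_or_image_in_clique[of f, OF fV fadj]
    show ?thesis
    proof
      assume "f ` pverts ?G = pverts ?G"
      then show ?thesis using onto_endomorphism_imp_automorphism[OF f] B.finite_V by blast
    next
      assume "\<exists>C\<in>stars m \<union> tops m. f ` pverts ?G \<subseteq> C"
      then obtain C where C: "C \<in> stars m \<union> tops m" "f ` pverts ?G \<subseteq> C" by blast
      have "graph_clique ?G (f ` pverts ?G)"
        unfolding graph_clique_def using C(2) fV B.adj_in_clique[OF C(1)]
        unfolding grassmann_adj_def by blast
      then show ?thesis using f by (auto simp: graph_colouring_def)
    qed
  qed
qed

theorem theorem1p1:
  fixes scale :: "'a::{field,finite} \<Rightarrow> 'v::ab_group_add \<Rightarrow> 'v"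
    and q n m :: nat
  assumes "primepow q" and "CARD('a) = q"
    and "vector_space scale" and "vector_space.dim scale UNIV = n"
    and "1 \<le> m" and "m < n"
  shows "pseudo_core (vector_space.grassmann_graph scale m)"
proof -
  interpret vector_space scale by fact
  obtain B where B: "independent B" "UNIV \<subseteq> span B" "card B = dim UNIV"
    using basis_exists[of UNIV] by auto
  \<comment> \<open>An infinite set has \<open>card\<close> equal to 0, which \<open>m < n\<close>
    rules out.\<close>
  have fB: "finite B" using B(3) assms by (metis card.infinite not_less_zero)
  interpret finite_dimensional_vector_space scale B
    by unfold_locales (use fB B in auto)
  have "finite (UNIV :: 'v set)"
  proof -
    \<comment> \<open>Finiteness of the space comes from its coordinates. Restricting the
      coefficient functions to \<open>B\<close> makes them range over a finite set.\<close>
    have "span B = (\<lambda>c. \<Sum>b\<in>B. scale (c b) b) ` (B \<rightarrow>\<^sub>E UNIV)"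
    proof (intro subset_antisym subsetI)
      fix x assume "x \<in> span B"
      then obtain c where "x = (\<Sum>b\<in>B. scale (c b) b)" using span_finite[OF fB] by auto
      then show "x \<in> (\<lambda>c. \<Sum>b\<in>B. scale (c b) b) ` (B \<rightarrow>\<^sub>E UNIV)"
        by (intro image_eqI[of _ _ "restrict c B"]) auto
    qed (use span_finite[OF fB] in auto)
    moreover have "finite (B \<rightarrow>\<^sub>E (UNIV :: 'a set))" using fB by (intro finite_PiE) auto
    ultimately have "finite (span B)" by simp
    then show ?thesis using B finite_subset by blast
  qed
  then show ?thesis by (rule pseudo_core_grassmann_graph) (use assms in auto)
qed

end
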